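(* Let $n\geq 1$ and $\nu\geq 1$ be integers, let $p\in(1,\infty)$, and let $f$ be a pluriharmonic function of $\mathbb{B}_{\ell_2^n}$ into $\mathbb{B}_{\ell_p^\nu}$. Then for every $z\in\mathbb{B}_{\ell_2^n}$, $$\big|\nabla\|f(z)\|_p\big|\leq\frac{4}{\pi}\,\frac{1}{1-\|z\|_2^2}.$$ Furthermore, this inequality is sharp for each $z\in\mathbb{B}_{\ell_2^n}$ (that is, for each $z$ there is such an $f$ for which equality holds at $z$).
   Context: For $p\in[1,\infty)$, $\|z\|_p=(\sum_j|z_j|^p)^{1/p}$, and $\|z\|_\infty=\max_j|z_j|$. $\mathbb{B}_{\ell_p^n}=\{z\in\mathbb{C}^n:\|z\|_p<1\}$. A twice continuously differentiable complex-valued function $f$ on a domain $\Omega\subset\mathbb{C}^n$ is pluriharmonic if for each fixed $z\in\Omega$ and $\theta\in\mathbb{C}^n$ with $\|\theta\|_2=1$, the function $\zeta\mapsto f(z+\zeta\theta)$ is harmonic in $\{\zeta\in\mathbb{C}:|\zeta|<d_\Omega(z)\}$, where $d_\Omega(z)$ is the Euclidean distance from $z$ to $\partial\Omega$; a vector-valued map is pluriharmonic if each component is. For a differentiable (in the real sense) map $f$, $$\big|\nabla\|f(z)\|_p\big|:=\limsup_{w\to z}\frac{\big|\|f(z)\|_p-\|f(w)\|_p\big|}{\|z-w\|_2}.$$ *)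

theory Defs
  imports "HOL-Analysis.Analysis"
begin

text \<open>The norm of \<^typ>\<open>complex ^ 'n\<close> provided by the library is the Euclidean norm, so
  \<^term>\<open>ball 0 1 :: (complex ^ 'n) set\<close> is the open unit ball of the Euclidean norm.\<close>

definition lp_norm :: "real \<Rightarrow> complex ^ 'n \<Rightarrow> real" where
  "lp_norm p z = (\<Sum>j\<in>UNIV. cmod (z $ j) powr p) powr (1 / p)"

definition lp_ball :: "real \<Rightarrow> (complex ^ 'n) set" where
  "lp_ball p = {z. lp_norm p z < 1}"

text \<open>Twice continuous differentiability in the real sense: on an open set, the first and second
  Frechet derivatives, as bounded real-linear maps, exist and the second one is continuous
  (the first one is then continuous as well).\<close>

definition C2_on :: "('a::real_normed_vector \<Rightarrow> 'b::real_normed_vector) \<Rightarrow> 'a set \<Rightarrow> bool" where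
  "C2_on f S \<longleftrightarrow>
     (\<exists>(f' :: 'a \<Rightarrow> 'a \<Rightarrow>\<^sub>L 'b) (f'' :: 'a \<Rightarrow> 'a \<Rightarrow>\<^sub>L 'a \<Rightarrow>\<^sub>L 'b).
        (\<forall>x\<in>S. (f has_derivative blinfun_apply (f' x)) (at x)) \<and>
        (\<forall>x\<in>S. (f' has_derivative blinfun_apply (f'' x)) (at x)) \<and>
        continuous_on S f'')"

definition dir_deriv :: "(complex \<Rightarrow> complex) \<Rightarrow> complex \<Rightarrow> complex \<Rightarrow> complex" where
  "dir_deriv g v \<zeta> = vector_derivative (\<lambda>t::real. g (\<zeta> + t *\<^sub>R v)) (at 0)"

text \<open>With \<open>\<zeta> = x + \<i> y\<close>, the partial derivatives in \<open>x\<close> and \<open>y\<close> are the real directional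
  derivatives along \<open>1\<close> and \<open>\<i>\<close>.\<close>

definition laplacian :: "(complex \<Rightarrow> complex) \<Rightarrow> complex \<Rightarrow> complex" where
  "laplacian g \<zeta> = dir_deriv (dir_deriv g 1) 1 \<zeta> + dir_deriv (dir_deriv g \<i>) \<i> \<zeta>"

definition harmonic_on :: "(complex \<Rightarrow> complex) \<Rightarrow> complex set \<Rightarrow> bool" where
  "harmonic_on g U \<longleftrightarrow> C2_on g U \<and> (\<forall>\<zeta>\<in>U. laplacian g \<zeta> = 0)"

text \<open>The extended reals make the distance to an empty boundary infinite (\<^const>\<open>infdist\<close> would
  give 0).\<close>

definition boundary_dist :: "(complex ^ 'n) set \<Rightarrow> complex ^ 'n \<Rightarrow> ereal" where
  "boundary_dist \<Omega> z = (INF w\<in>frontier \<Omega>. ereal (dist z w))"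

text \<open>Intended for open connected \<open>\<Omega>\<close>.\<close>

definition pluriharmonic_on :: "(complex ^ 'n \<Rightarrow> complex) \<Rightarrow> (complex ^ 'n) set \<Rightarrow> bool" where
  "pluriharmonic_on f \<Omega> \<longleftrightarrow>
     C2_on f \<Omega> \<and>
     (\<forall>z\<in>\<Omega>. \<forall>\<theta>. norm \<theta> = 1 \<longrightarrow>
        harmonic_on (\<lambda>\<zeta>. f (z + \<zeta> *s \<theta>)) {\<zeta>. ereal (cmod \<zeta>) < boundary_dist \<Omega> z})"

definition pluriharmonic_map_on ::
    "(complex ^ 'n \<Rightarrow> complex ^ 'm) \<Rightarrow> (complex ^ 'n) set \<Rightarrow> bool" where
  "pluriharmonic_map_on f \<Omega> \<longleftrightarrow> (\<forall>j. pluriharmonic_on (\<lambda>z. f z $ j) \<Omega>)"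

definition grad_lp_norm :: "real \<Rightarrow> (complex ^ 'n \<Rightarrow> complex ^ 'm) \<Rightarrow> complex ^ 'n \<Rightarrow> ereal" where
  "grad_lp_norm p f z =
     Limsup (at z) (\<lambda>w. ereal (\<bar>lp_norm p (f z) - lp_norm p (f w)\<bar> / norm (z - w)))"

end

theory Submission
  imports Defs "HOL-Complex_Analysis.Riemann_Mapping"
begin

text \<open>
  The upper bound reduces to real-valued harmonic functions by duality. Given \<open>x\<close> in the ball, choose a
  complex-linear functional \<open>l\<close> on the target with \<open>\<bar>l w\<bar> \<le> \<parallel>w\<parallel>\<^sub>p\<close> for all \<open>w\<close> and \<open>l (f x) = \<parallel>f x\<parallel>\<^sub>p\<close>
  (\<open>lp_norm_dual\<close>). Then \<open>F = Re (l \<circ> f)\<close> is a real pluriharmonic function with values in \<open>(-1, 1)\<close>, and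
  \<open>\<parallel>f x\<parallel>\<^sub>p - \<parallel>f y\<parallel>\<^sub>p \<le> F x - F y\<close>, since \<open>F y \<le> \<parallel>f y\<parallel>\<^sub>p\<close>. So every bound on the gradient of such
  functions \<open>F\<close> bounds the local Lipschitz constant of \<open>\<parallel>f\<parallel>\<^sub>p\<close>, even where \<open>\<parallel>f\<parallel>\<^sub>p\<close> is not
  differentiable.

  To bound the derivative of \<open>F\<close> at \<open>y\<close> in a unit direction \<open>\<theta>\<close>, restrict \<open>F\<close> to the complex line
  \<open>y + \<complex>\<theta>\<close>. It meets the ball in a disc centred at the point \<open>z\<close> of the line that is nearest to the origin,
  of radius \<open>R = sqrt (1 - \<parallel>z\<parallel>\<^sup>2)\<close>, and \<open>y\<close> is the point with parameter \<open>a\<close> in that disc, where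
  \<open>\<parallel>y\<parallel>\<^sup>2 = \<parallel>z\<parallel>\<^sup>2 + \<bar>a\<bar>\<^sup>2\<close>. The restriction is the real part of a holomorphic function \<open>H\<close> from the disc into
  the strip \<open>\<bar>Re\<bar> < 1\<close>; as \<open>tan (pi H / 4)\<close> maps into the unit disc, the Schwarz-Pick lemma gives
  (\<open>harmonic_gradient_bound\<close>)
  \<open>\<bar>H' a\<bar> \<le> (4 / pi) R / (R\<^sup>2 - \<bar>a\<bar>\<^sup>2) = (4 / pi) R / (1 - \<parallel>y\<parallel>\<^sup>2)\<close>, and \<open>R \<le> 1\<close>.

  Equality is attained at \<open>z = r e\<close>, with \<open>e\<close> a unit vector and \<open>0 \<le> r\<close>, by composing the orthogonal projection
  to the disc \<open>\<zeta> e\<close> with the automorphism of the disc that moves \<open>r\<close> to \<open>0\<close> and with \<open>(4 / pi) Re \<circ> arctan\<close>,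
  and by placing the result in one coordinate of the target (\<open>sharp_pluriharmonic_map\<close>). This function
  vanishes at \<open>z\<close>, so there its modulus has the same slope as the function itself along the line
  \<open>z + \<real>e\<close>; the upper bound already proved supplies the other inequality.
\<close>

section \<open>Norming functionals for the \<open>p\<close>-norm\<close>

lemma lp_norm_nonneg: "0 \<le> lp_norm p z"
  by (simp add: lp_norm_def)

lemma lp_norm_powr: "p \<noteq> 0 \<Longrightarrow> lp_norm p z powr p = (\<Sum>j\<in>UNIV. cmod (z $ j) powr p)"
  by (simp add: lp_norm_def powr_powr sum_nonneg)

lemma lp_norm_eq_0D: "lp_norm p z = 0 \<Longrightarrow> z = 0"
  by (simp add: lp_norm_def vec_eq_iff sum_nonneg_eq_0_iff)

lemma lp_norm_sum_normalized:
  assumes "p \<noteq> 0" "lp_norm p z \<noteq> 0"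
  shows "(\<Sum>j\<in>UNIV. (cmod (z $ j) / lp_norm p z) powr p) = 1"
proof -
  have "(\<Sum>j\<in>UNIV. (cmod (z $ j) / lp_norm p z) powr p)
      = (\<Sum>j\<in>UNIV. cmod (z $ j) powr p) / lp_norm p z powr p"
    by (simp add: powr_divide lp_norm_nonneg sum_divide_distrib)
  then show ?thesis
    using assms by (simp flip: lp_norm_powr)
qed

text \<open>For \<open>v \<noteq> 0\<close>, the norming functional \<open>l\<^sub>j = cnj (sgn v\<^sub>j) (\<bar>v\<^sub>j\<bar> / N) powr (p - 1)\<close> with \<open>N = \<parallel>v\<parallel>\<^sub>p\<close> has conjugate norm
  \<open>1\<close>, so the first property is Hoelder's inequality. It follows from Young's inequality, applied to the
  normalized entries and summed.\<close>

lemma lp_norm_dual: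
  fixes v :: "complex ^ 'm"
  assumes "1 < p"
  obtains l :: "complex ^ 'm"
  where "\<And>w. cmod (\<Sum>j\<in>UNIV. l $ j * w $ j) \<le> lp_norm p w"
    and "(\<Sum>j\<in>UNIV. l $ j * v $ j) = of_real (lp_norm p v)"
proof (cases "lp_norm p v = 0")
  case True
  with that[of 0] show ?thesis by (simp add: lp_norm_nonneg)
next
  case False
  define N where "N = lp_norm p v"
  have N: "N > 0" using False lp_norm_nonneg[of p v] by (simp add: N_def)
  define a where "a j = cmod (v $ j) / N" for j
  have a0: "a j \<ge> 0" for j using N by (simp add: a_def)
  have sum_a: "(\<Sum>j\<in>UNIV. a j powr p) = 1"
    using lp_norm_sum_normalized[of p v] assms False by (simp add: a_def N_def)
  define l :: "complex ^ 'm" where "l = (\<chi> j. cnj (sgn (v $ j)) * of_real (a j powr (p - 1)))"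
  have norm_l: "cmod (l $ j) \<le> a j powr (p - 1)" for j
    by (simp add: l_def norm_mult norm_sgn)
  have "cmod (\<Sum>j\<in>UNIV. l $ j * w $ j) \<le> lp_norm p w" for w
  proof (cases "lp_norm p w = 0")
    case True
    then show ?thesis using lp_norm_eq_0D[OF True] by simp
  next
    case False
    define M where "M = lp_norm p w"
    have M: "M > 0" using False lp_norm_nonneg[of p w] by (simp add: M_def)
    define b where "b j = cmod (w $ j) / M" for j
    have b0: "b j \<ge> 0" for j using M by (simp add: b_def)
    have sum_b: "(\<Sum>j\<in>UNIV. b j powr p) = 1"
      using lp_norm_sum_normalized[of p w] assms False by (simp add: b_def M_def)
    define q where "q = p / (p - 1)"
    have q: "q > 1" "1 / q + 1 / p = 1" "(p - 1) * q = p"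
      using assms by (auto simp: q_def field_simps)
    have young: "a j powr (p - 1) * b j \<le> a j powr p / q + b j powr p / p" for j
      using Youngs_inequality[of q p "a j powr (p - 1)" "b j"] q assms b0[of j] by (simp add: powr_powr)
    have "cmod (\<Sum>j\<in>UNIV. l $ j * w $ j) \<le> (\<Sum>j\<in>UNIV. a j powr (p - 1) * (M * b j))"
    proof (rule sum_norm_le)
      fix j
      show "cmod (l $ j * w $ j) \<le> a j powr (p - 1) * (M * b j)"
        using norm_l[of j] M by (simp add: norm_mult b_def mult_right_mono)
    qed
    also have "\<dots> = M * (\<Sum>j\<in>UNIV. a j powr (p - 1) * b j)"
      by (simp add: sum_distrib_left mult_ac)
    also have "\<dots> \<le> M * (\<Sum>j\<in>UNIV. a j powr p / q + b j powr p / p)"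
      using M by (intro mult_left_mono sum_mono young) auto
    also have "\<dots> = M"
      using q by (simp add: sum.distrib flip: sum_divide_distrib) (simp add: sum_a sum_b)
    finally show ?thesis by (simp add: M_def)
  qed
  moreover have "(\<Sum>j\<in>UNIV. l $ j * v $ j) = of_real (lp_norm p v)"
  proof -
    have "l $ j * v $ j = of_real (N * a j powr p)" for j
    proof (cases "v $ j = 0")
      case True
      then show ?thesis by (simp add: a_def)
    next
      case False
      have "a j > 0" using False N by (simp add: a_def)
      then have "a j powr p = a j powr (p - 1) * a j"
        by (simp add: powr_diff)
      moreover have "cnj (sgn (v $ j)) * v $ j = of_real (N * a j)"
        using N False
        using complex_norm_square[of "v $ j"]
        by (simp add: a_def sgn_div_norm scaleR_conv_of_real divide_simps power2_eq_square mult.commute)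
      ultimately show ?thesis
        by (simp add: l_def mult_ac)
    qed
    then have "(\<Sum>j\<in>UNIV. l $ j * v $ j) = of_real (N * (\<Sum>j\<in>UNIV. a j powr p))"
      by (simp add: sum_distrib_left)
    then show ?thesis by (simp add: sum_a N_def)
  qed
  ultimately show ?thesis using that by blast
qed


section \<open>Symmetry of the second derivative\<close>

text \<open>Both values are limits of the second difference
  \<open>f (x + h v + h w) - f (x + h v) - f (x + h w) + f x\<close>, divided by \<open>h\<^sup>2\<close>, which is symmetric in \<open>v\<close> and
  \<open>w\<close>. The mean value inequality for \<open>s \<mapsto> f (x + s v + h w) - f (x + s v)\<close> bounds the error by the
  remainder of the first-order expansion of \<open>f'\<close> at \<open>x\<close>, which is
  \<open>o(h)\<close>.\<close>

lemma second_derivative_symmetric: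
  fixes f :: "'a::real_normed_vector \<Rightarrow> 'b::real_normed_vector"
    and f' :: "'a \<Rightarrow> 'a \<Rightarrow>\<^sub>L 'b" and f'' :: "'a \<Rightarrow> 'a \<Rightarrow>\<^sub>L 'b"
  assumes "open S" "x \<in> S"
    and f': "\<And>y. y \<in> S \<Longrightarrow> (f has_derivative blinfun_apply (f' y)) (at y)"
    and f'': "(f' has_derivative f'') (at x)"
  shows "f'' v w = f'' w v"
proof -
  define K where "K = norm v + norm w"
  have lin: "linear f''" using f'' by (simp add: has_derivative_linear)
  have *: "\<exists>d>0. \<forall>h. 0 < h \<and> h < d \<longrightarrow>
      norm ((f (x + h *\<^sub>R v + h *\<^sub>R w) - f (x + h *\<^sub>R v) - f (x + h *\<^sub>R w) + f x)
         - (h * h) *\<^sub>R f'' w v) \<le> 2 * e * (K * K) * (h * h)"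
    if "e > 0" and K: "norm v + norm w = K" for e v w
  proof -
    obtain d1 where d1: "d1 > 0" "ball x d1 \<subseteq> S"
      using assms(1,2) openE by blast
    obtain d2 where d2: "d2 > 0"
      "\<And>y. norm (y - x) < d2 \<Longrightarrow> norm (f' y - f' x - f'' (y - x)) \<le> e * norm (y - x)"
      using f'' \<open>e > 0\<close> unfolding has_derivative_at_alt by blast
    define d where "d = min d1 d2 / (K + 1)"
    have K0: "K \<ge> 0" using K by auto
    have d: "d > 0" using d1 d2 K0 by (simp add: d_def)
    have "norm ((f (x + h *\<^sub>R v + h *\<^sub>R w) - f (x + h *\<^sub>R v) - f (x + h *\<^sub>R w) + f x)
         - (h * h) *\<^sub>R f'' w v) \<le> 2 * e * (K * K) * (h * h)" if h: "0 < h" "h < d" for h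
    proof -
      have hK: "h * K < d1" "h * K < d2"
      proof -
        have "h * (K + 1) < min d1 d2" using h K0 by (simp add: d_def field_simps)
        then show "h * K < d1" "h * K < d2" using h by (auto simp: algebra_simps)
      qed
      have near: "norm (s *\<^sub>R v + t *\<^sub>R w) \<le> h * K" if "0 \<le> s" "s \<le> h" "0 \<le> t" "t \<le> h" for s t
      proof -
        have "norm (s *\<^sub>R v + t *\<^sub>R w) \<le> s * norm v + t * norm w"
          using that by (metis abs_of_nonneg norm_scaleR norm_triangle_ineq)
        also have "\<dots> \<le> h * norm v + h * norm w"
          using that by (intro add_mono mult_right_mono) auto
        finally show ?thesis by (simp add: K[symmetric] algebra_simps)
      qed
      have inS: "x + s *\<^sub>R v + t *\<^sub>R w \<in> S" if "0 \<le> s" "s \<le> h" "0 \<le> t" "t \<le> h" for s t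
      proof -
        have "dist (x + s *\<^sub>R v + t *\<^sub>R w) x < d1"
          using near[OF that] hK by (simp add: dist_norm add.assoc)
        then show ?thesis using d1 by (auto simp: dist_commute)
      qed
      define R where "R y = f' y - f' x - f'' (y - x)" for y
      have R: "norm (R (x + s *\<^sub>R v + t *\<^sub>R w)) \<le> e * (h * K)"
        if "0 \<le> s" "s \<le> h" "0 \<le> t" "t \<le> h" for s t
      proof -
        have n: "norm (x + s *\<^sub>R v + t *\<^sub>R w - x) \<le> h * K"
          using near[OF that] by (simp add: add.assoc)
        then have "norm (R (x + s *\<^sub>R v + t *\<^sub>R w)) \<le> e * norm (x + s *\<^sub>R v + t *\<^sub>R w - x)"
          unfolding R_def using hK by (intro d2(2)) linarith
        also have "\<dots> \<le> e * (h * K)" using n \<open>e > 0\<close> by (intro mult_left_mono) auto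
        finally show ?thesis .
      qed
      \<comment> \<open>The subtracted linear term makes \<open>\<phi>' s\<close> a difference of two remainders \<open>R\<close>.\<close>
      define \<phi> where "\<phi> s = f (x + s *\<^sub>R v + h *\<^sub>R w) - f (x + s *\<^sub>R v + 0 *\<^sub>R w) - (s * h) *\<^sub>R f'' w v" for s :: real
      define \<phi>' where "\<phi>' s t = t *\<^sub>R ((R (x + s *\<^sub>R v + h *\<^sub>R w) - R (x + s *\<^sub>R v + 0 *\<^sub>R w)) v)" for s t :: real
      have chain: "((\<lambda>s. f (x + s *\<^sub>R v + t *\<^sub>R w)) has_derivative
          (\<lambda>u. f' (x + s *\<^sub>R v + t *\<^sub>R w) (u *\<^sub>R v))) (at s within {0..h})"
        if "0 \<le> s" "s \<le> h" "0 \<le> t" "t \<le> h" for s t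
        by (rule has_derivative_compose[where g = f and f = "\<lambda>s. x + s *\<^sub>R v + t *\<^sub>R w", OF _ f'[OF inS[OF that]]])
           (auto intro!: derivative_eq_intros)
      have der: "(\<phi> has_derivative \<phi>' s) (at s within {0..h})" if s: "s \<in> {0..h}" for s
      proof -
        have eq: "\<phi>' s = (\<lambda>u. f' (x + s *\<^sub>R v + h *\<^sub>R w) (u *\<^sub>R v) - f' (x + s *\<^sub>R v + 0 *\<^sub>R w) (u *\<^sub>R v)
               - (u * h) *\<^sub>R f'' w v)"
          by (auto simp: fun_eq_iff \<phi>'_def R_def blinfun.bilinear_simps linear_add[OF lin] linear_scale[OF lin] algebra_simps)
        then show ?thesis
          unfolding \<phi>_def eq using s h
          by (intro has_derivative_diff chain) (auto intro!: derivative_eq_intros)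
      qed
      have on: "onorm (\<phi>' s) \<le> 2 * e * (K * K) * h" if s: "s \<in> {0..h}" for s
      proof (rule onorm_le)
        fix t
        let ?D = "R (x + s *\<^sub>R v + h *\<^sub>R w) - R (x + s *\<^sub>R v + 0 *\<^sub>R w)"
        have "norm ?D \<le> e * (h * K) + e * (h * K)"
          using R[of s h] R[of s 0] s h by (intro order_trans[OF norm_triangle_ineq4 add_mono]) auto
        moreover have "norm v \<le> K" using K[symmetric] by simp
        ultimately have "norm (?D v) \<le> (e * (h * K) + e * (h * K)) * K"
          using K0 h \<open>e > 0\<close> by (intro order_trans[OF norm_blinfun mult_mono]) auto
        then have "norm (?D v) \<le> (2 * (e * (h * K))) * K"
          by (simp add: algebra_simps)
        then have "\<bar>t\<bar> * norm (?D v) \<le> \<bar>t\<bar> * ((2 * (e * (h * K))) * K)"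
          by (intro mult_left_mono) auto
        then show "norm (\<phi>' s t) \<le> 2 * e * (K * K) * h * norm t"
          by (simp add: \<phi>'_def mult_ac)
      qed
      have "norm (\<phi> h - \<phi> 0) \<le> 2 * e * (K * K) * h * norm (h - 0)"
        using h by (intro differentiable_bound[of "{0..h}" \<phi> \<phi>'] der on) auto
      then show ?thesis using h by (simp add: \<phi>_def algebra_simps)
    qed
    with d show ?thesis by blast
  qed
  have "norm (f'' w v - f'' v w) \<le> e" if "e > 0" for e
  proof -
    \<comment> \<open>The summand \<open>1\<close> keeps the denominator positive when \<open>K = 0\<close>.\<close>
    define e' where "e' = e / (4 * (K * K) + 1)"
    have e': "e' > 0" "4 * e' * (K * K) \<le> e"
    proof -
      have "4 * (K * K) + 1 > 0" by (simp add: add_nonneg_pos)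
      then show "e' > 0" "4 * e' * (K * K) \<le> e" using that by (simp_all add: e'_def field_simps)
    qed
    obtain d1 where d1: "d1 > 0" "\<And>h. 0 < h \<and> h < d1 \<Longrightarrow>
       norm ((f (x + h *\<^sub>R v + h *\<^sub>R w) - f (x + h *\<^sub>R v) - f (x + h *\<^sub>R w) + f x)
         - (h * h) *\<^sub>R f'' w v) \<le> 2 * e' * (K * K) * (h * h)"
      using *[OF e'(1), of v w] K_def by blast
    obtain d2 where d2: "d2 > 0" "\<And>h. 0 < h \<and> h < d2 \<Longrightarrow>
       norm ((f (x + h *\<^sub>R w + h *\<^sub>R v) - f (x + h *\<^sub>R w) - f (x + h *\<^sub>R v) + f x)
         - (h * h) *\<^sub>R f'' v w) \<le> 2 * e' * (K * K) * (h * h)"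
      using *[OF e'(1), of w v] K_def by (auto simp: add.commute)
    define h where "h = min d1 d2 / 2"
    have h: "0 < h" "h < d1" "h < d2" using d1 d2 by (auto simp: h_def)
    let ?D = "f (x + h *\<^sub>R v + h *\<^sub>R w) - f (x + h *\<^sub>R v) - f (x + h *\<^sub>R w) + f x"
    have 1: "norm (?D - (h * h) *\<^sub>R f'' w v) \<le> 2 * e' * (K * K) * (h * h)"
      using d1 h by blast
    have "f (x + h *\<^sub>R w + h *\<^sub>R v) - f (x + h *\<^sub>R w) - f (x + h *\<^sub>R v) + f x = ?D"
      by (simp add: algebra_simps)
    with d2(2)[of h] h have 2: "norm (?D - (h * h) *\<^sub>R f'' v w) \<le> 2 * e' * (K * K) * (h * h)"
      by simp
    have "(h * h) *\<^sub>R (f'' w v - f'' v w) = (?D - (h * h) *\<^sub>R f'' v w) - (?D - (h * h) *\<^sub>R f'' w v)"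
      by (simp add: algebra_simps)
    then have "norm ((h * h) *\<^sub>R (f'' w v - f'' v w)) \<le> 2 * e' * (K * K) * (h * h) + 2 * e' * (K * K) * (h * h)"
      using norm_triangle_ineq4[of "?D - (h * h) *\<^sub>R f'' v w" "?D - (h * h) *\<^sub>R f'' w v"] 1 2
      by (simp only:)
    then have "(h * h) * norm (f'' w v - f'' v w) \<le> (h * h) * (4 * e' * (K * K))"
      unfolding norm_scaleR using h by (simp add: mult_ac)
    then have "norm (f'' w v - f'' v w) \<le> 4 * e' * (K * K)"
      using h by simp
    with e' show ?thesis by linarith
  qed
  then have "norm (f'' w v - f'' v w) \<le> 0"
    by (rule dense_ge)
  then show ?thesis by simp
qed

section \<open>Bounded real harmonic functions on a disc\<close>

lemma Moebius_denominator_nonzero: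
  assumes "cmod w < 1" "cmod z < 1"
  shows "1 - cnj w * z \<noteq> 0"
proof
  assume "1 - cnj w * z = 0"
  then have "cmod (cnj w * z) = 1" by simp
  moreover have "cmod (cnj w * z) < 1" using assms norm_mult_less[of "cnj w" 1 z 1] by simp
  ultimately show False by simp
qed

lemma Moebius_function_has_field_derivative:
  assumes "cmod w < 1" "cmod z < 1"
  shows "(Moebius_function 0 w has_field_derivative
    of_real (1 - (cmod w)\<^sup>2) / (1 - cnj w * z)\<^sup>2) (at z)"
proof -
  note nz = Moebius_denominator_nonzero[OF assms]
  have "((\<lambda>z. (z - w) / (1 - cnj w * z)) has_field_derivative
     (1 * (1 - cnj w * z) - (z - w) * (0 - cnj w * 1)) / ((1 - cnj w * z) * (1 - cnj w * z))) (at z)"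
    using nz by (auto intro!: derivative_eq_intros)
  moreover have "1 * (1 - cnj w * z) - (z - w) * (0 - cnj w * 1) = of_real (1 - (cmod w)\<^sup>2)"
    by (simp add: algebra_simps complex_norm_square del: of_real_power)
  ultimately show ?thesis
    by (simp only: Moebius_function_simple[abs_def] power2_eq_square[of "1 - cnj w * z"])
qed

text \<open>Move \<open>a\<close> and \<open>G a\<close> to the origin by automorphisms of the disc and apply the Schwarz lemma to the
  resulting self-map of the disc that fixes \<open>0\<close>.\<close>

lemma Schwarz_Pick_deriv_unit:
  assumes G: "G holomorphic_on ball 0 1" and bd: "\<And>z. cmod z < 1 \<Longrightarrow> cmod (G z) < 1"
    and a: "cmod a < 1"
  shows "cmod (deriv G a) * (1 - (cmod a)\<^sup>2) \<le> 1 - (cmod (G a))\<^sup>2"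
proof -
  define H where "H z = Moebius_function 0 (G a) (G (Moebius_function 0 (- a) z))" for z
  have a': "cmod (- a) < 1" using a by simp
  have Ga: "cmod (G a) < 1" by (simp add: a bd)
  have M0: "Moebius_function 0 (- a) 0 = a" by (simp add: Moebius_function_of_zero)
  have "H holomorphic_on ball 0 1"
    unfolding H_def
  proof (rule holomorphic_on_compose_gen[OF holomorphic_on_compose_gen[OF
        Moebius_function_holomorphic[OF a', of 0] G] Moebius_function_holomorphic[OF Ga, of 0], unfolded o_def])
    show "Moebius_function 0 (- a) ` ball 0 1 \<subseteq> ball 0 1"
      using Moebius_function_norm_lt_1[OF a', of _ 0] by auto
    then show "(\<lambda>x. G (Moebius_function 0 (- a) x)) ` ball 0 1 \<subseteq> ball 0 1"
      using bd by (force simp: image_subset_iff)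
  qed
  moreover have "H 0 = 0"
    by (simp add: H_def M0 Moebius_function_eq_zero)
  moreover have "cmod (H z) < 1" if "cmod z < 1" for z
    unfolding H_def by (intro Moebius_function_norm_lt_1 bd that a' Ga)
  ultimately have le: "cmod (deriv H 0) \<le> 1"
    by (rule Schwarz_Lemma(2)[where \<xi> = 0]) auto
  have "(Moebius_function 0 (- a) has_field_derivative of_real (1 - (cmod a)\<^sup>2)) (at 0)"
    using Moebius_function_has_field_derivative[OF a', of 0] by simp
  moreover have "(G has_field_derivative deriv G a) (at (Moebius_function 0 (- a) 0))"
    using G a by (simp add: M0 holomorphic_derivI)
  moreover have "(Moebius_function 0 (G a) has_field_derivative
     of_real (1 - (cmod (G a))\<^sup>2) / (1 - cnj (G a) * G a)\<^sup>2) (at (G (Moebius_function 0 (- a) 0)))"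
    using Moebius_function_has_field_derivative[OF Ga Ga] by (simp add: M0)
  ultimately have "(H has_field_derivative of_real (1 - (cmod (G a))\<^sup>2) / (1 - cnj (G a) * G a)\<^sup>2
      * (deriv G a * of_real (1 - (cmod a)\<^sup>2))) (at 0)"
    unfolding H_def by (intro DERIV_chain2)
  moreover have "1 - cnj (G a) * G a = of_real (1 - (cmod (G a))\<^sup>2)"
    by (simp add: complex_norm_square mult.commute del: of_real_power)
  ultimately have "deriv H 0 = of_real (1 - (cmod (G a))\<^sup>2) / (of_real (1 - (cmod (G a))\<^sup>2))\<^sup>2
      * (deriv G a * of_real (1 - (cmod a)\<^sup>2))"
    by (simp add: DERIV_imp_deriv del: of_real_diff)
  also have "\<dots> = deriv G a * of_real (1 - (cmod a)\<^sup>2) / of_real (1 - (cmod (G a))\<^sup>2)"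
    by (simp add: power2_eq_square del: of_real_diff)
  finally have eq: "cmod (deriv H 0) = cmod (deriv G a) * \<bar>1 - (cmod a)\<^sup>2\<bar> / \<bar>1 - (cmod (G a))\<^sup>2\<bar>"
    by (simp only: norm_divide norm_mult norm_of_real)
  have "(cmod a)\<^sup>2 < 1" "(cmod (G a))\<^sup>2 < 1"
    using a Ga by (auto simp: power_less_one_iff abs_square_less_1)
  with le eq show ?thesis by (simp add: divide_simps)
qed

lemma Schwarz_Pick_deriv:
  assumes G: "G holomorphic_on ball 0 R" and bd: "\<And>z. cmod z < R \<Longrightarrow> cmod (G z) < 1"
    and a: "cmod a < R"
  shows "cmod (deriv G a) * (R\<^sup>2 - (cmod a)\<^sup>2) \<le> R * (1 - (cmod (G a))\<^sup>2)"
proof -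
  have R: "R > 0" using a by (smt (verit) norm_ge_zero)
  define H where "H z = G (of_real R * z)" for z
  have "H holomorphic_on ball 0 1"
    unfolding H_def
    by (rule holomorphic_on_compose_gen[OF _ G, unfolded o_def])
       (use R in \<open>auto intro!: holomorphic_intros simp: norm_mult\<close>)
  moreover have "cmod (H z) < 1" if "cmod z < 1" for z
    unfolding H_def using R that by (intro bd) (simp add: norm_mult)
  moreover have "cmod (a / R) < 1" using R a by (simp add: norm_divide)
  ultimately have "cmod (deriv H (a / R)) * (1 - (cmod (a / R))\<^sup>2) \<le> 1 - (cmod (H (a / R)))\<^sup>2"
    by (rule Schwarz_Pick_deriv_unit)
  moreover have "(H has_field_derivative deriv G a * (of_real R * 1)) (at (a / R))"
    unfolding H_def
    by (rule DERIV_chain2) (use G a R in \<open>auto intro!: derivative_eq_intros holomorphic_derivI\<close>)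
  then have "deriv H (a / R) = deriv G a * of_real R" by (simp add: DERIV_imp_deriv)
  ultimately have "cmod (deriv G a) * R * (1 - (cmod a / R)\<^sup>2) \<le> 1 - (cmod (G a))\<^sup>2"
    using R by (simp add: norm_mult norm_divide H_def)
  then have "R * (cmod (deriv G a) * R * (1 - (cmod a / R)\<^sup>2)) \<le> R * (1 - (cmod (G a))\<^sup>2)"
    using R by (intro mult_left_mono) auto
  moreover have "R * (cmod (deriv G a) * R * (1 - (cmod a / R)\<^sup>2)) = cmod (deriv G a) * (R\<^sup>2 - (cmod a)\<^sup>2)"
    using R by (simp add: field_simps power2_eq_square)
  ultimately show ?thesis by simp
qed

text \<open>Hence \<open>tan\<close> maps the strip \<open>\<bar>Re z\<bar> < pi / 4\<close> into the unit disc, and \<open>1 - \<bar>tan z\<bar>\<^sup>2\<close> is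
  \<open>cos (2 Re z) / \<bar>cos z\<bar>\<^sup>2\<close>, where \<open>1 / cos\<^sup>2\<close> is the derivative of \<open>tan\<close>.\<close>

lemma norm_cos_squared_minus_norm_sin_squared:
  "(cmod (cos z))\<^sup>2 - (cmod (sin z))\<^sup>2 = cos (2 * Re z)"
proof -
  have "exp (2 * Im z) = (exp (Im z))\<^sup>2" by (simp add: exp_double)
  then show ?thesis
    unfolding norm_cos_squared norm_sin_squared cos_double_cos
    by (simp add: field_simps power2_eq_square)
qed

text \<open>A function whose derivative is \<open>h \<mapsto> Re (k z * h)\<close> with \<open>k\<close> holomorphic is harmonic, and \<open>cmod (k z)\<close> is
  the length of its gradient; this form of harmonicity makes \<open>u\<close>, up to a constant, the real part
  of a primitive of \<open>k\<close>. The Schwarz-Pick lemma applied to the tangent of this primitive, scaled and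
  shifted into the strip \<open>\<bar>Re\<bar> < pi / 4\<close>, even gives the bound with the extra factor \<open>cos (pi u(a) / 2) \<le> 1\<close>.\<close>

lemma harmonic_gradient_bound:
  fixes u :: "complex \<Rightarrow> real"
  assumes u: "\<And>z. cmod z < R \<Longrightarrow> (u has_derivative (\<lambda>h. Re (k z * h))) (at z)"
    and k: "k holomorphic_on ball 0 R"
    and bd: "\<And>z. cmod z < R \<Longrightarrow> \<bar>u z\<bar> < 1"
    and a: "cmod a < R"
  shows "cmod (k a) * (R\<^sup>2 - (cmod a)\<^sup>2) \<le> 4 / pi * R"
proof -
  have R: "R > 0" using a by (smt (verit) norm_ge_zero)
  obtain g where g: "\<And>z. z \<in> ball 0 R \<Longrightarrow> (g has_field_derivative k z) (at z within ball 0 R)"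
    using holomorphic_convex_primitive'[OF convex_ball open_ball k] by blast
  have g': "(g has_field_derivative k z) (at z)" if "cmod z < R" for z
    using g[of z] that by (simp add: at_within_open[of z "ball 0 R"])
  have "((\<lambda>z. Re (g z) - u z) has_derivative (\<lambda>h. 0)) (at z within ball 0 R)" if "z \<in> ball 0 R" for z
  proof -
    have "((\<lambda>z. Re (g z) - u z) has_derivative (\<lambda>h. Re (k z * h) - Re (k z * h))) (at z)"
      using that g'[of z] u[of z]
      by (intro has_derivative_diff bounded_linear.has_derivative[OF bounded_linear_Re])
         (auto simp: has_field_derivative_def)
    then show ?thesis by (auto intro: has_derivative_at_withinI)
  qed
  then obtain c where c: "\<And>z. z \<in> ball 0 R \<Longrightarrow> Re (g z) - u z = c"
    using has_derivative_zero_constant[OF convex_ball, of 0 R "\<lambda>z. Re (g z) - u z"] by blast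
  define H where "H z = of_real (pi / 4) * (g z - of_real c)" for z
  have ReH: "Re (H z) = pi / 4 * u z" if "cmod z < R" for z
    using c[of z] that by (simp add: H_def)
  have H: "(H has_field_derivative of_real (pi / 4) * k z) (at z)" if "cmod z < R" for z
    unfolding H_def using g'[OF that] by (auto intro!: derivative_eq_intros)
  have cos_pos: "cos (2 * Re (H z)) > 0" if "cmod z < R" for z
  proof (rule cos_gt_zero_pi)
    have "pi / 2 * \<bar>u z\<bar> < pi / 2" using bd[OF that] by simp
    then have "\<bar>2 * Re (H z)\<bar> < pi / 2" unfolding ReH[OF that] by (simp add: abs_mult)
    then show "- (pi / 2) < 2 * Re (H z)" "2 * Re (H z) < pi / 2" by auto
  qed
  have sin_cos: "(cmod (sin (H z)))\<^sup>2 < (cmod (cos (H z)))\<^sup>2" if "cmod z < R" for z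
    using cos_pos[OF that] norm_cos_squared_minus_norm_sin_squared[of "H z"] by linarith
  have cos_nz: "cos (H z) \<noteq> 0" if "cmod z < R" for z
    using sin_cos[OF that] by auto
  define G where "G z = tan (H z)" for z
  have G': "(G has_field_derivative of_real (pi / 4) * k z / (cos (H z))\<^sup>2) (at z)" if "cmod z < R" for z
    unfolding G_def
    by (rule DERIV_cong[OF DERIV_chain2[OF DERIV_tan H[OF that]]])
       (use cos_nz[OF that] in \<open>auto simp: field_simps\<close>)
  have "G holomorphic_on ball 0 R"
    using G' by (auto simp: holomorphic_on_open intro!: exI)
  moreover have "cmod (G z) < 1" if "cmod z < R" for z
  proof -
    have "cmod (sin (H z)) < cmod (cos (H z))" using sin_cos[OF that] by (simp add: power_less_imp_less_base)
    then show ?thesis by (simp add: G_def tan_def norm_divide cos_nz[OF that])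
  qed
  ultimately have "cmod (deriv G a) * (R\<^sup>2 - (cmod a)\<^sup>2) \<le> R * (1 - (cmod (G a))\<^sup>2)"
    using a by (rule Schwarz_Pick_deriv)
  moreover have "cmod (deriv G a) = pi / 4 * cmod (k a) / (cmod (cos (H a)))\<^sup>2"
    using DERIV_imp_deriv[OF G'[OF a]] by (simp add: norm_mult norm_divide norm_power)
  moreover have "1 - (cmod (G a))\<^sup>2 = cos (2 * Re (H a)) / (cmod (cos (H a)))\<^sup>2"
    using cos_nz[OF a] unfolding norm_cos_squared_minus_norm_sin_squared[of "H a", symmetric]
    by (simp add: G_def tan_def norm_divide power_divide diff_divide_distrib)
  ultimately have "pi / 4 * cmod (k a) * (R\<^sup>2 - (cmod a)\<^sup>2) / (cmod (cos (H a)))\<^sup>2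
      \<le> R * cos (2 * Re (H a)) / (cmod (cos (H a)))\<^sup>2"
    by simp
  then have "pi / 4 * cmod (k a) * (R\<^sup>2 - (cmod a)\<^sup>2) \<le> R * cos (2 * Re (H a))"
    using cos_nz[OF a] unfolding divide_le_cancel by auto
  also have "\<dots> \<le> R" using R by simp
  finally show ?thesis by (simp add: field_simps)
qed

section \<open>Restriction of pluriharmonic functions to complex lines\<close>

text \<open>A segment that leaves \<open>\<Omega>\<close> crosses the boundary; so the disc in the definition of
  pluriharmonicity stays inside \<open>\<Omega>\<close>.\<close>

lemma boundary_dist_le:
  assumes "z \<in> \<Omega>" "y \<notin> \<Omega>"
  shows "boundary_dist \<Omega> z \<le> ereal (dist z y)"
proof -
  have "closed_segment z y \<inter> frontier \<Omega> \<noteq> {}"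
    using assms by (intro connected_Int_frontier) auto
  then obtain w where w: "w \<in> closed_segment z y" "w \<in> frontier \<Omega>" by blast
  have "boundary_dist \<Omega> z \<le> ereal (dist z w)"
    unfolding boundary_dist_def using w by (intro INF_lower)
  also have "\<dots> \<le> ereal (dist z y)"
    using segment_bound(1)[OF w(1)] by (simp add: dist_norm norm_minus_commute)
  finally show ?thesis .
qed

lemma boundary_dist_pos:
  assumes "open \<Omega>" "z \<in> \<Omega>"
  shows "boundary_dist \<Omega> z > 0"
proof -
  obtain e where e: "e > 0" "ball z e \<subseteq> \<Omega>" using assms openE by blast
  have "ereal e \<le> boundary_dist \<Omega> z"
    unfolding boundary_dist_def
  proof (rule INF_greatest)
    fix w assume "w \<in> frontier \<Omega>"
    then have "w \<notin> \<Omega>" using assms(1) by (simp add: frontier_def interior_open)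
    then have "w \<notin> ball z e" using e(2) by blast
    then show "ereal e \<le> ereal (dist z w)" by simp
  qed
  moreover have "0 < ereal e" using e(1) by simp
  ultimately show ?thesis by (rule less_le_trans[rotated])
qed

lemma bounded_linear_vector_scalar_mult_left:
  "bounded_linear (\<lambda>\<zeta>::complex. \<zeta> *s (\<theta> :: complex ^ 'n))"
  unfolding linear_conv_bounded_linear[symmetric]
  by (rule linearI) (auto simp: vec_eq_iff vector_scalar_mult_def algebra_simps)

lemma slice_has_derivative:
  fixes f :: "complex ^ 'n \<Rightarrow> 'b::real_normed_vector"
  assumes "(f has_derivative D) (at (z + \<zeta> *s \<theta>))"
  shows "((\<lambda>\<zeta>. f (z + \<zeta> *s \<theta>)) has_derivative (\<lambda>h. D (h *s \<theta>))) (at \<zeta>)"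
  by (rule has_derivative_compose[where g = f and f = "\<lambda>\<zeta>. z + \<zeta> *s \<theta>", OF _ assms])
     (auto intro!: derivative_eq_intros bounded_linear.has_derivative[OF bounded_linear_vector_scalar_mult_left])

lemma dir_deriv_eq:
  assumes "(g has_derivative D) (at \<zeta>)"
  shows "dir_deriv g v \<zeta> = D v"
proof -
  have "((\<lambda>t::real. \<zeta> + t *\<^sub>R v) has_derivative (\<lambda>t. t *\<^sub>R v)) (at 0)"
    by (auto intro!: derivative_eq_intros)
  then have "((\<lambda>t::real. g (\<zeta> + t *\<^sub>R v)) has_derivative (\<lambda>t. D (t *\<^sub>R v))) (at 0)"
    by (rule has_derivative_compose) (use assms in simp)
  then have "((\<lambda>t::real. g (\<zeta> + t *\<^sub>R v)) has_vector_derivative D v) (at 0)"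
    using linear_scale[OF has_derivative_linear[OF assms]] by (simp add: has_vector_derivative_def)
  then show ?thesis by (simp add: dir_deriv_def vector_derivative_at)
qed

text \<open>The inner directional derivative has to be identified on a whole neighbourhood of the point
  before it can be differentiated; hence the open set \<open>U\<close>.\<close>

lemma dir_deriv_dir_deriv_eq:
  assumes "open U" "\<zeta> \<in> U"
    and g: "\<And>y. y \<in> U \<Longrightarrow> (g has_derivative g' y) (at y)"
    and g': "((\<lambda>y. g' y v) has_derivative D) (at \<zeta>)"
  shows "dir_deriv (dir_deriv g v) w \<zeta> = D w"
proof (rule dir_deriv_eq)
  show "(dir_deriv g v has_derivative D) (at \<zeta>)"
    by (rule has_derivative_transform_within_open[OF g' assms(1,2)]) (simp add: dir_deriv_eq[OF g])
qed

text \<open>Pluriharmonicity only speaks of discs around each point of \<open>\<Omega>\<close> that stay away from the boundary.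
  Since every point of \<open>\<Omega>\<close> is the centre of such a disc, evaluating the Laplace equation at the centres
  gives it everywhere, in terms of the second derivative of \<open>f\<close> itself.\<close>

lemma pluriharmonic_second_derivative:
  fixes f :: "complex ^ 'n \<Rightarrow> complex"
    and f' :: "complex ^ 'n \<Rightarrow> (complex ^ 'n) \<Rightarrow>\<^sub>L complex"
  assumes "pluriharmonic_on f \<Omega>" "open \<Omega>" "z \<in> \<Omega>" "norm \<theta> = 1"
    and f': "\<And>y. y \<in> \<Omega> \<Longrightarrow> (f has_derivative blinfun_apply (f' y)) (at y)"
    and f'': "(f' has_derivative f'') (at z)"
  shows "f'' (\<i> *s \<theta>) (\<i> *s \<theta>) = - f'' \<theta> \<theta>"
proof -
  define g where "g \<zeta> = f (z + \<zeta> *s \<theta>)" for \<zeta>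
  have "laplacian g 0 = 0"
    using assms(1,3,4) boundary_dist_pos[OF assms(2,3)]
    unfolding pluriharmonic_on_def harmonic_on_def g_def by (auto simp: zero_ereal_def)
  define U where "U = {\<zeta>. z + \<zeta> *s \<theta> \<in> \<Omega>}"
  have U: "open U" "0 \<in> U"
    unfolding U_def using assms(2,3)
    by (auto intro!: open_vimage[unfolded vimage_def] continuous_intros
        linear_continuous_on[OF bounded_linear_vector_scalar_mult_left] simp: vec.scale_zero_left)
  have g': "(g has_derivative (\<lambda>h. f' (z + \<zeta> *s \<theta>) (h *s \<theta>))) (at \<zeta>)" if "\<zeta> \<in> U" for \<zeta>
    unfolding g_def using that by (intro slice_has_derivative f') (simp add: U_def)
  have g'': "((\<lambda>\<zeta>. f' (z + \<zeta> *s \<theta>) (v *s \<theta>)) has_derivative (\<lambda>h. f'' (h *s \<theta>) (v *s \<theta>))) (at 0)" for v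
    using f'' by (intro slice_has_derivative[where f = "\<lambda>y. f' y (v *s \<theta>)"]
        bounded_linear.has_derivative[OF blinfun.bounded_linear_left]) simp
  show ?thesis
    using \<open>laplacian g 0 = 0\<close> dir_deriv_dir_deriv_eq[OF U g' g''[of 1], of 1]
      dir_deriv_dir_deriv_eq[OF U g' g''[of \<i>], of \<i>]
    by (simp add: laplacian_def eq_neg_iff_add_eq_0 add.commute)
qed

text \<open>The Cauchy-Riemann equation in one line: a real-linear map that commutes with multiplication
  by \<open>\<i>\<close> at \<open>1\<close> is complex-linear.\<close>

lemma real_derivative_cmult_imp_field_derivative:
  fixes T :: "complex \<Rightarrow> complex"
  assumes "(g has_derivative T) (at z)" "T \<i> = \<i> * T 1"
  shows "(g has_field_derivative T 1) (at z)"
proof -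
  have lin: "linear T" using assms(1) by (rule has_derivative_linear)
  have "T h = T 1 * h" for h
  proof -
    have "h = Re h *\<^sub>R 1 + Im h *\<^sub>R \<i>" by (simp add: complex_eq_iff)
    then have "T h = Re h *\<^sub>R T 1 + Im h *\<^sub>R T \<i>"
      by (metis linear_add[OF lin] linear_scale[OF lin])
    also have "\<dots> = T 1 * (Re h *\<^sub>R 1 + Im h *\<^sub>R \<i>)"
      by (simp add: assms(2) algebra_simps scaleR_conv_of_real)
    finally show ?thesis using \<open>h = _\<close> by simp
  qed
  then have "T = (\<lambda>h. T 1 * h)" by blast
  then show ?thesis using assms(1) by (metis has_field_derivative_def)
qed

text \<open>On a complex line, the derivative of \<open>f\<close> splits into a complex-linear and a conjugate-linear
  part, with the Wirtinger derivatives \<open>A = \<partial>f\<close> and \<open>cnj C\<close> as coefficients; the conjugate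
  is there because \<open>C\<close>, and not \<open>cnj C\<close>, is holomorphic. The Cauchy-Riemann equations for \<open>A\<close> and for \<open>C\<close> are the Laplace equation
  together with the symmetry of the second derivative.\<close>

lemma pluriharmonic_slice_derivative:
  fixes f :: "complex ^ 'n \<Rightarrow> complex"
  assumes ph: "pluriharmonic_on f \<Omega>" and "open \<Omega>" and \<theta>: "norm \<theta> = 1"
  obtains A C where "A holomorphic_on {\<zeta>. z + \<zeta> *s \<theta> \<in> \<Omega>}" "C holomorphic_on {\<zeta>. z + \<zeta> *s \<theta> \<in> \<Omega>}"
    "\<And>\<zeta>. z + \<zeta> *s \<theta> \<in> \<Omega> \<Longrightarrow>
      ((\<lambda>\<zeta>. f (z + \<zeta> *s \<theta>)) has_derivative (\<lambda>h. A \<zeta> * h + cnj (C \<zeta> * h))) (at \<zeta>)"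
proof -
  obtain f' :: "complex ^ 'n \<Rightarrow> (complex ^ 'n) \<Rightarrow>\<^sub>L complex"
    and f'' :: "complex ^ 'n \<Rightarrow> (complex ^ 'n) \<Rightarrow>\<^sub>L (complex ^ 'n) \<Rightarrow>\<^sub>L complex"
    where f': "\<And>y. y \<in> \<Omega> \<Longrightarrow> (f has_derivative blinfun_apply (f' y)) (at y)"
      and f'': "\<And>y. y \<in> \<Omega> \<Longrightarrow> (f' has_derivative blinfun_apply (f'' y)) (at y)"
    using ph unfolding pluriharmonic_on_def C2_on_def by blast
  let ?y = "\<lambda>\<zeta>. z + \<zeta> *s \<theta>"
  \<comment> \<open>The vector \<open>1 *s \<theta>\<close> is written so that all terms are instances of \<open>h *s \<theta>\<close> at \<open>h = 1\<close>.\<close>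
  define A where "A \<zeta> = (1 / 2) * (f' (?y \<zeta>) (1 *s \<theta>) - \<i> * f' (?y \<zeta>) (\<i> *s \<theta>))" for \<zeta>
  define C where "C \<zeta> = cnj ((1 / 2) * (f' (?y \<zeta>) (1 *s \<theta>) + \<i> * f' (?y \<zeta>) (\<i> *s \<theta>)))" for \<zeta>
  have op: "open {\<zeta>. ?y \<zeta> \<in> \<Omega>}"
    using \<open>open \<Omega>\<close>
    by (auto intro!: open_vimage[unfolded vimage_def] continuous_intros
        linear_continuous_on[OF bounded_linear_vector_scalar_mult_left])
  have sym: "f'' y (\<i> *s \<theta>) \<theta> = f'' y \<theta> (\<i> *s \<theta>)" if "y \<in> \<Omega>" for y
    using second_derivative_symmetric[OF \<open>open \<Omega>\<close> that f' f''[OF that]] .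
  have lap: "f'' y (\<i> *s \<theta>) (\<i> *s \<theta>) = - f'' y \<theta> \<theta>" if "y \<in> \<Omega>" for y
    using pluriharmonic_second_derivative[OF ph \<open>open \<Omega>\<close> that \<theta> f' f''[OF that]] by simp
  have g'': "((\<lambda>\<zeta>. f' (?y \<zeta>) v) has_derivative (\<lambda>h. f'' (?y \<zeta>) (h *s \<theta>) v)) (at \<zeta>)"
    if "?y \<zeta> \<in> \<Omega>" for v \<zeta>
    using f''[OF that] by (intro slice_has_derivative[where f = "\<lambda>y. f' y v"]
        bounded_linear.has_derivative[OF blinfun.bounded_linear_left])
  have "(A has_field_derivative
      (1 / 2) * (f'' (?y \<zeta>) (1 *s \<theta>) (1 *s \<theta>) - \<i> * f'' (?y \<zeta>) (1 *s \<theta>) (\<i> *s \<theta>))) (at \<zeta>)"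
    if "?y \<zeta> \<in> \<Omega>" for \<zeta>
  proof (rule real_derivative_cmult_imp_field_derivative[where T = "\<lambda>h. (1 / 2) * (f'' (?y \<zeta>) (h *s \<theta>) (1 *s \<theta>) - \<i> * f'' (?y \<zeta>) (h *s \<theta>) (\<i> *s \<theta>))"])
    show "(A has_derivative (\<lambda>h. (1 / 2) * (f'' (?y \<zeta>) (h *s \<theta>) (1 *s \<theta>) - \<i> * f'' (?y \<zeta>) (h *s \<theta>) (\<i> *s \<theta>)))) (at \<zeta>)"
      unfolding A_def by (intro has_derivative_mult_right has_derivative_diff g'' that)
  qed (simp add: sym[OF that] lap[OF that] algebra_simps)
  then have hol_A: "A holomorphic_on {\<zeta>. ?y \<zeta> \<in> \<Omega>}"
    using op by (auto simp: holomorphic_on_open)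
  have "(C has_field_derivative
      cnj ((1 / 2) * (f'' (?y \<zeta>) (1 *s \<theta>) (1 *s \<theta>) + \<i> * f'' (?y \<zeta>) (1 *s \<theta>) (\<i> *s \<theta>)))) (at \<zeta>)"
    if "?y \<zeta> \<in> \<Omega>" for \<zeta>
  proof (rule real_derivative_cmult_imp_field_derivative[where T = "\<lambda>h. cnj ((1 / 2) * (f'' (?y \<zeta>) (h *s \<theta>) (1 *s \<theta>) + \<i> * f'' (?y \<zeta>) (h *s \<theta>) (\<i> *s \<theta>)))"])
    show "(C has_derivative (\<lambda>h. cnj ((1 / 2) * (f'' (?y \<zeta>) (h *s \<theta>) (1 *s \<theta>) + \<i> * f'' (?y \<zeta>) (h *s \<theta>) (\<i> *s \<theta>))))) (at \<zeta>)"
      unfolding C_def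
      by (intro bounded_linear.has_derivative[OF bounded_linear_cnj] has_derivative_mult_right has_derivative_add g'' that)
  qed (simp add: sym[OF that] lap[OF that] algebra_simps)
  then have hol_C: "C holomorphic_on {\<zeta>. ?y \<zeta> \<in> \<Omega>}"
    using op by (auto simp: holomorphic_on_open)
  have der: "((\<lambda>\<zeta>. f (?y \<zeta>)) has_derivative (\<lambda>h. A \<zeta> * h + cnj (C \<zeta> * h))) (at \<zeta>)"
    if "?y \<zeta> \<in> \<Omega>" for \<zeta>
  proof -
    have "f' (?y \<zeta>) (h *s \<theta>) = A \<zeta> * h + cnj (C \<zeta> * h)" for h
    proof -
      have "h *s \<theta> = Re h *\<^sub>R (1 *s \<theta>) + Im h *\<^sub>R (\<i> *s \<theta>)"
        by (simp add: vec_eq_iff complex_eq_iff)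
      then have "f' (?y \<zeta>) (h *s \<theta>) = Re h *\<^sub>R f' (?y \<zeta>) (1 *s \<theta>) + Im h *\<^sub>R f' (?y \<zeta>) (\<i> *s \<theta>)"
        by (simp only: blinfun.bilinear_simps)
      also have "\<dots> = A \<zeta> * h + cnj (C \<zeta> * h)"
        unfolding A_def C_def by (simp add: complex_eq_iff field_simps)
      finally show ?thesis .
    qed
    then show ?thesis using slice_has_derivative[OF f'[OF that]] by simp
  qed
  show ?thesis by (rule that[OF hol_A hol_C der])
qed

section \<open>Discs cut out of the ball by complex lines\<close>

definition hermitian :: "complex ^ 'n \<Rightarrow> complex ^ 'n \<Rightarrow> complex" where
  "hermitian x y = (\<Sum>j\<in>UNIV. x $ j * cnj (y $ j))"

lemma norm_squared_vec: "(norm x)\<^sup>2 = (\<Sum>j\<in>UNIV. (cmod (x $ j))\<^sup>2)" for x :: "complex ^ 'n"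
  by (simp add: norm_vec_def L2_set_def sum_nonneg)

lemma hermitian_self: "hermitian x x = of_real ((norm x)\<^sup>2)"
  unfolding norm_squared_vec hermitian_def by (simp add: complex_norm_square del: of_real_power)

lemma hermitian_smult_left: "hermitian (c *s x) y = c * hermitian x y"
  by (simp add: hermitian_def sum_distrib_left mult.assoc)

text \<open>Pythagoras for the foot of the perpendicular from the origin to the complex line through \<open>y\<close> in
  direction \<open>\<theta>\<close>: the line meets every ball around the origin in a disc centred at this foot.\<close>

lemma norm_orthogonal_part_plus:
  assumes \<theta>: "norm \<theta> = 1"
  shows "(norm (y - hermitian y \<theta> *s \<theta> + \<zeta> *s \<theta>))\<^sup>2
    = (norm (y - hermitian y \<theta> *s \<theta>))\<^sup>2 + (cmod \<zeta>)\<^sup>2"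
proof -
  define z where "z = y - hermitian y \<theta> *s \<theta>"
  have "hermitian z \<theta> = hermitian y \<theta> - hermitian (hermitian y \<theta> *s \<theta>) \<theta>"
    by (simp add: z_def hermitian_def left_diff_distrib sum_subtractf)
  then have orth: "hermitian z \<theta> = 0"
    by (simp add: hermitian_smult_left hermitian_self \<theta>)
  have "(cmod (z $ j + \<zeta> * \<theta> $ j))\<^sup>2
      = (cmod (z $ j))\<^sup>2 + (cmod \<zeta>)\<^sup>2 * (cmod (\<theta> $ j))\<^sup>2 + 2 * Re (cnj \<zeta> * (z $ j * cnj (\<theta> $ j)))" for j
    unfolding cmod_power2 by (simp add: power2_eq_square algebra_simps)
  then have "(norm (z + \<zeta> *s \<theta>))\<^sup>2
      = (norm z)\<^sup>2 + (cmod \<zeta>)\<^sup>2 * (norm \<theta>)\<^sup>2 + 2 * Re (cnj \<zeta> * hermitian z \<theta>)"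
    unfolding norm_squared_vec hermitian_def
    by (simp only: vector_add_component vector_smult_component sum.distrib sum_distrib_left Re_sum)
  then show ?thesis by (simp add: orth \<theta> flip: z_def)
qed

lemma norm_hermitian_le:
  assumes "norm \<theta> = 1"
  shows "cmod (hermitian y \<theta>) \<le> norm y"
  using norm_orthogonal_part_plus[OF assms, of y "hermitian y \<theta>"]
  by (simp add: power2_le_imp_le)

section \<open>The upper bound\<close>

text \<open>On the complex line through \<open>y\<close> in a unit direction \<open>\<theta>\<close>, the function is harmonic on the full disc of
  radius \<open>R\<close> in which the line meets the ball, and \<open>harmonic_gradient_bound\<close> applies at the parameter \<open>a\<close>
  of \<open>y\<close>. The denominator \<open>R\<^sup>2 - \<bar>a\<bar>\<^sup>2 = 1 - \<parallel>y\<parallel>\<^sup>2\<close> is the same for all directions; the numerator \<open>R\<close> is at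
  most \<open>1\<close>.\<close>

lemma pluriharmonic_functional_derivative_bound:
  fixes f :: "complex ^ 'n \<Rightarrow> complex ^ 'm" and l :: "complex ^ 'm"
  assumes ph: "pluriharmonic_map_on f (ball 0 1)"
    and bd: "\<And>y. y \<in> ball 0 1 \<Longrightarrow> \<bar>Re (\<Sum>j\<in>UNIV. l $ j * f y $ j)\<bar> < 1"
    and y: "y \<in> ball 0 1"
  obtains D where "((\<lambda>y. Re (\<Sum>j\<in>UNIV. l $ j * f y $ j)) has_derivative D) (at y)"
    and "onorm D \<le> 4 / pi * (1 / (1 - (norm y)\<^sup>2))"
proof -
  let ?F = "\<lambda>y. Re (\<Sum>j\<in>UNIV. l $ j * f y $ j)"
  have phj: "pluriharmonic_on (\<lambda>y. f y $ j) (ball 0 1)" for j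
    using ph by (simp add: pluriharmonic_map_on_def)
  have "\<forall>j. \<exists>d. ((\<lambda>y. f y $ j) has_derivative d) (at y)"
    using phj y unfolding pluriharmonic_on_def C2_on_def by blast
  from choice[OF this] obtain d where d: "\<And>j. ((\<lambda>y. f y $ j) has_derivative d j) (at y)" by blast
  define D where "D v = Re (\<Sum>j\<in>UNIV. l $ j * d j v)" for v
  have D: "(?F has_derivative D) (at y)"
    unfolding D_def by (intro bounded_linear.has_derivative[OF bounded_linear_Re] has_derivative_sum
        has_derivative_mult_right d)
  have lin: "linear D" using D by (rule has_derivative_linear)
  have ny: "(norm y)\<^sup>2 < 1" using y by (simp add: abs_square_less_1)
  have unit: "\<bar>D \<theta>\<bar> \<le> 4 / pi * (1 / (1 - (norm y)\<^sup>2))" if \<theta>: "norm \<theta> = 1" for \<theta>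
  proof -
    define a where "a = hermitian y \<theta>"
    define z where "z = y - a *s \<theta>"
    have yz: "y = z + a *s \<theta>" by (simp add: z_def)
    have norm_z: "(norm (z + \<zeta> *s \<theta>))\<^sup>2 = (norm z)\<^sup>2 + (cmod \<zeta>)\<^sup>2" for \<zeta>
      unfolding z_def a_def by (rule norm_orthogonal_part_plus[OF \<theta>])
    have ny': "(norm y)\<^sup>2 = (norm z)\<^sup>2 + (cmod a)\<^sup>2" using norm_z[of a] yz by simp
    define R where "R = sqrt (1 - (norm z)\<^sup>2)"
    have R2: "R\<^sup>2 = 1 - (norm z)\<^sup>2"
      using ny ny' by (simp add: R_def) (smt (verit) zero_le_power2)
    have R0: "0 \<le> R" "R \<le> 1" using R2 ny ny' by (auto simp: R_def)
    have disc: "z + \<zeta> *s \<theta> \<in> ball 0 1 \<longleftrightarrow> cmod \<zeta> < R" for \<zeta>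
    proof -
      have "z + \<zeta> *s \<theta> \<in> ball 0 1 \<longleftrightarrow> (norm (z + \<zeta> *s \<theta>))\<^sup>2 < 1"
        by (simp add: abs_square_less_1)
      also have "\<dots> \<longleftrightarrow> (cmod \<zeta>)\<^sup>2 < R\<^sup>2" by (auto simp: norm_z R2)
      also have "\<dots> \<longleftrightarrow> cmod \<zeta> < R" using R0 by (simp add: power_mono_iff flip: not_le)
      finally show ?thesis .
    qed
    have disc_eq: "{\<zeta>. cmod \<zeta> < R} = ball 0 R" by auto
    have "\<forall>j. \<exists>A C. A holomorphic_on ball 0 R \<and> C holomorphic_on ball 0 R \<and>
       (\<forall>\<zeta>. cmod \<zeta> < R \<longrightarrow> ((\<lambda>\<zeta>. f (z + \<zeta> *s \<theta>) $ j) has_derivative (\<lambda>h. A \<zeta> * h + cnj (C \<zeta> * h))) (at \<zeta>))"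
      by (rule allI, rule pluriharmonic_slice_derivative[OF phj open_ball \<theta>, of z, unfolded disc disc_eq]) blast
    from choice[OF this] obtain A where "\<forall>j. \<exists>C. A j holomorphic_on ball 0 R \<and> C holomorphic_on ball 0 R \<and>
       (\<forall>\<zeta>. cmod \<zeta> < R \<longrightarrow> ((\<lambda>\<zeta>. f (z + \<zeta> *s \<theta>) $ j) has_derivative (\<lambda>h. A j \<zeta> * h + cnj (C \<zeta> * h))) (at \<zeta>))" ..
    from choice[OF this] obtain C where A: "\<And>j. A j holomorphic_on ball 0 R" and C: "\<And>j. C j holomorphic_on ball 0 R"
      and AC: "\<And>j \<zeta>. cmod \<zeta> < R \<Longrightarrow>
        ((\<lambda>\<zeta>. f (z + \<zeta> *s \<theta>) $ j) has_derivative (\<lambda>h. A j \<zeta> * h + cnj (C j \<zeta> * h))) (at \<zeta>)"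
      by blast
    \<comment> \<open>Since \<open>Re (l * cnj w) = Re (cnj l * w)\<close>, the conjugate-linear parts also contribute
      holomorphic terms to the real part.\<close>
    define k where "k \<zeta> = (\<Sum>j\<in>UNIV. l $ j * A j \<zeta> + cnj (l $ j) * C j \<zeta>)" for \<zeta>
    have k: "k holomorphic_on ball 0 R"
      unfolding k_def by (intro holomorphic_intros A C)
    have u: "((\<lambda>\<zeta>. ?F (z + \<zeta> *s \<theta>)) has_derivative (\<lambda>h. Re (k \<zeta> * h))) (at \<zeta>)" if "cmod \<zeta> < R" for \<zeta>
    proof -
      have "((\<lambda>\<zeta>. ?F (z + \<zeta> *s \<theta>)) has_derivative
          (\<lambda>h. Re (\<Sum>j\<in>UNIV. l $ j * (A j \<zeta> * h + cnj (C j \<zeta> * h))))) (at \<zeta>)"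
        by (intro bounded_linear.has_derivative[OF bounded_linear_Re] has_derivative_sum
            has_derivative_mult_right AC that)
      moreover have "Re (\<Sum>j\<in>UNIV. l $ j * (A j \<zeta> * h + cnj (C j \<zeta> * h))) = Re (k \<zeta> * h)" for h
        unfolding k_def sum_distrib_right Re_sum by (intro sum.cong refl) (simp add: algebra_simps)
      ultimately show ?thesis by simp
    qed
    have "cmod a < R" using disc[of a] y yz by simp
    have "((\<lambda>\<zeta>. ?F (z + \<zeta> *s \<theta>)) has_derivative (\<lambda>h. D (h *s \<theta>))) (at a)"
      using D yz by (intro slice_has_derivative[where f = ?F]) simp
    with u[OF \<open>cmod a < R\<close>] have "(\<lambda>h. Re (k a * h)) = (\<lambda>h. D (h *s \<theta>))"
      by (rule has_derivative_unique)
    from fun_cong[OF this, of 1] have "D \<theta> = Re (k a)" by simp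
    then have "\<bar>D \<theta>\<bar> \<le> cmod (k a)" by (simp add: abs_Re_le_cmod)
    moreover have "cmod (k a) * (R\<^sup>2 - (cmod a)\<^sup>2) \<le> 4 / pi * R"
      by (rule harmonic_gradient_bound[where u = "\<lambda>\<zeta>. ?F (z + \<zeta> *s \<theta>)", OF u k _ \<open>cmod a < R\<close>])
         (simp_all only: bd flip: disc)
    moreover have "R\<^sup>2 - (cmod a)\<^sup>2 = 1 - (norm y)\<^sup>2" by (simp add: R2 ny')
    moreover have "4 / pi * R \<le> 4 / pi * 1" using R0 by (intro mult_left_mono) auto
    ultimately have "cmod (k a) * (1 - (norm y)\<^sup>2) \<le> 4 / pi" by simp
    then have "cmod (k a) \<le> 4 / pi / (1 - (norm y)\<^sup>2)" using ny by (subst pos_le_divide_eq) auto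
    with \<open>\<bar>D \<theta>\<bar> \<le> cmod (k a)\<close> show ?thesis by simp
  qed
  have "onorm D \<le> 4 / pi * (1 / (1 - (norm y)\<^sup>2))"
  proof (rule onorm_le)
    fix v
    show "norm (D v) \<le> 4 / pi * (1 / (1 - (norm y)\<^sup>2)) * norm v"
    proof (cases "v = 0")
      case True
      then show ?thesis by (simp add: linear_0[OF lin])
    next
      case False
      then have "D v = norm v * D (sgn v)"
        by (simp add: sgn_div_norm linear_scale[OF lin])
      then have "norm (D v) = \<bar>D (sgn v)\<bar> * norm v" by (simp add: abs_mult)
      also have "\<dots> \<le> 4 / pi * (1 / (1 - (norm y)\<^sup>2)) * norm v"
        using False by (intro mult_right_mono unit) (simp_all add: norm_sgn)
      finally show ?thesis .
    qed
  qed
  with D show ?thesis by (rule that)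
qed

text \<open>The functional that norms \<open>f x\<close> gives \<open>\<parallel>f x\<parallel>\<^sub>p = F x\<close> and \<open>F y \<le> \<parallel>f y\<parallel>\<^sub>p\<close> for the same \<open>F = Re (l \<circ> f)\<close>, so
  the mean value inequality for \<open>F\<close> on the ball of radius \<open>r\<close> suffices.\<close>

lemma lp_norm_lipschitz:
  fixes f :: "complex ^ 'n \<Rightarrow> complex ^ 'm"
  assumes "1 < p" and ph: "pluriharmonic_map_on f (ball 0 1)" and im: "f ` ball 0 1 \<subseteq> lp_ball p"
    and r: "r < 1" and x: "norm x \<le> r" and y: "norm y \<le> r"
  shows "lp_norm p (f x) - lp_norm p (f y) \<le> 4 / pi * (1 / (1 - r\<^sup>2)) * norm (x - y)"
proof -
  obtain l :: "complex ^ 'm" where l: "\<And>w. cmod (\<Sum>j\<in>UNIV. l $ j * w $ j) \<le> lp_norm p w"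
    and lx: "(\<Sum>j\<in>UNIV. l $ j * f x $ j) = of_real (lp_norm p (f x))"
    using lp_norm_dual[OF \<open>1 < p\<close>] by blast
  let ?F = "\<lambda>y. Re (\<Sum>j\<in>UNIV. l $ j * f y $ j)"
  have le: "\<bar>?F y\<bar> \<le> lp_norm p (f y)" for y
    by (rule order_trans[OF abs_Re_le_cmod l])
  have bd: "\<bar>?F y\<bar> < 1" if "y \<in> ball 0 1" for y
    using im that le[of y] by (force simp: lp_ball_def)
  have "\<forall>y\<in>ball 0 1. \<exists>D. (?F has_derivative D) (at y) \<and> onorm D \<le> 4 / pi * (1 / (1 - (norm y)\<^sup>2))"
    by (intro ballI, rule pluriharmonic_functional_derivative_bound[OF ph bd]) blast+
  from bchoice[OF this] obtain D where D: "\<And>y. y \<in> ball 0 1 \<Longrightarrow> (?F has_derivative D y) (at y)"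
    "\<And>y. y \<in> ball 0 1 \<Longrightarrow> onorm (D y) \<le> 4 / pi * (1 / (1 - (norm y)\<^sup>2))"
    by blast
  have "norm (?F x - ?F y) \<le> 4 / pi * (1 / (1 - r\<^sup>2)) * norm (x - y)"
  proof (rule differentiable_bound[of "cball 0 r" ?F D])
    fix w :: "complex ^ 'n" assume w: "w \<in> cball 0 r"
    then have w1: "w \<in> ball 0 1" using r by simp
    show "(?F has_derivative D w) (at w within cball 0 r)"
      using D(1)[OF w1] by (rule has_derivative_at_withinI)
    have r0: "0 \<le> r" using w by (simp add: order_trans[OF norm_ge_zero])
    have "(norm w)\<^sup>2 \<le> r\<^sup>2" using w by (intro power_mono) auto
    moreover have "r\<^sup>2 < 1" using r r0 by (simp add: abs_square_less_1)
    ultimately have "1 / (1 - (norm w)\<^sup>2) \<le> 1 / (1 - r\<^sup>2)" by (intro divide_left_mono mult_pos_pos) auto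
    then have "4 / pi * (1 / (1 - (norm w)\<^sup>2)) \<le> 4 / pi * (1 / (1 - r\<^sup>2))" by (intro mult_left_mono) auto
    with D(2)[OF w1] show "onorm (D w) \<le> 4 / pi * (1 / (1 - r\<^sup>2))" by linarith
  qed (use x y in auto)
  moreover have "?F x = lp_norm p (f x)" by (simp add: lx)
  ultimately show ?thesis using le[of y] by simp
qed

lemma grad_lp_norm_le:
  fixes f :: "complex ^ 'n \<Rightarrow> complex ^ 'm"
  assumes "1 < p" "pluriharmonic_map_on f (ball 0 1)" "f ` ball 0 1 \<subseteq> lp_ball p" and z: "z \<in> ball 0 1"
  shows "grad_lp_norm p f z \<le> ereal (4 / pi * (1 / (1 - (norm z)\<^sup>2)))"
proof -
  \<comment> \<open>Both points lie in the closed ball of radius \<open>max (norm z) (norm w)\<close>, which shrinks to \<open>norm z\<close>.\<close>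
  define B where "B w = 4 / pi * (1 / (1 - (max (norm z) (norm w))\<^sup>2))" for w :: "complex ^ 'n"
  have "eventually (\<lambda>w. w \<in> ball 0 1 \<and> w \<noteq> z) (at z)"
    using z by (intro eventually_conj eventually_at_in_open' eventually_neq_at_within) auto
  then have "eventually (\<lambda>w. ereal (\<bar>lp_norm p (f z) - lp_norm p (f w)\<bar> / norm (z - w)) \<le> ereal (B w)) (at z)"
  proof eventually_elim
    case (elim w)
    have "lp_norm p (f z) - lp_norm p (f w) \<le> B w * norm (z - w)"
      unfolding B_def using elim z by (intro lp_norm_lipschitz assms) auto
    moreover have "lp_norm p (f w) - lp_norm p (f z) \<le> B w * norm (w - z)"
      unfolding B_def using elim z by (intro lp_norm_lipschitz assms) auto
    ultimately have "\<bar>lp_norm p (f z) - lp_norm p (f w)\<bar> \<le> B w * norm (z - w)"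
      by (simp add: norm_minus_commute abs_le_iff)
    moreover have "norm (z - w) > 0" using elim by auto
    ultimately show ?case by (simp only: ereal_less_eq pos_divide_le_eq)
  qed
  then have "grad_lp_norm p f z \<le> Limsup (at z) (\<lambda>w. ereal (B w))"
    unfolding grad_lp_norm_def by (rule Limsup_mono)
  also have "(B \<longlongrightarrow> B z) (at z)"
    unfolding B_def using z by (intro tendsto_intros) (auto simp: abs_square_eq_1)
  then have "Limsup (at z) (\<lambda>w. ereal (B w)) = ereal (B z)"
    by (intro lim_imp_Limsup) (auto simp: trivial_limit_at)
  finally show ?thesis by (simp add: B_def)
qed

section \<open>Real parts of holomorphic functions\<close>

text \<open>The chain rule with values in spaces of bounded linear maps: the first derivative is
  \<open>\<Phi> (h' (c + L x))\<close> and the second is \<open>\<Psi> (h'' (c + L x))\<close>, for bounded linear maps \<open>\<Phi>\<close> and \<open>\<Psi>\<close> that depend on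
  \<open>L\<close> alone.\<close>

lemma C2_on_Re_holomorphic_affine:
  fixes L :: "'a::real_normed_vector \<Rightarrow>\<^sub>L complex"
  assumes h: "h holomorphic_on S" and S: "open S"
  shows "C2_on (\<lambda>x. complex_of_real (Re (h (c + L x)))) {x. c + L x \<in> S}"
proof -
  define R :: "complex \<Rightarrow>\<^sub>L complex" where "R = Blinfun (\<lambda>w. complex_of_real (Re w))"
  have R: "blinfun_apply R = (\<lambda>w. complex_of_real (Re w))"
    unfolding R_def by (intro bounded_linear_Blinfun_apply
        bounded_linear_compose[OF bounded_linear_of_real bounded_linear_Re])
  define \<Phi> :: "complex \<Rightarrow> 'a \<Rightarrow>\<^sub>L complex" where "\<Phi> w = R o\<^sub>L (blinfun_mult_right w o\<^sub>L L)" for w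
  have \<Phi>: "blinfun_apply (\<Phi> w) = (\<lambda>v. complex_of_real (Re (w * L v)))" for w
    by (simp add: fun_eq_iff \<Phi>_def R blinfun_mult_right.rep_eq)
  have bl\<Phi>: "bounded_linear \<Phi>"
    unfolding \<Phi>_def
    by (intro bounded_linear_compose[OF bounded_bilinear.bounded_linear_right[OF bounded_bilinear_blinfun_compose]]
        bounded_linear_compose[OF bounded_bilinear.bounded_linear_left[OF bounded_bilinear_blinfun_compose]] bounded_linear_blinfun_mult_right)
  define \<Psi> :: "complex \<Rightarrow> 'a \<Rightarrow>\<^sub>L 'a \<Rightarrow>\<^sub>L complex" where
    "\<Psi> w = Blinfun \<Phi> o\<^sub>L (blinfun_mult_right w o\<^sub>L L)" for w
  have \<Psi>: "blinfun_apply (\<Psi> w) = (\<lambda>v. \<Phi> (w * L v))" for w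
    by (simp add: fun_eq_iff \<Psi>_def bounded_linear_Blinfun_apply[OF bl\<Phi>] blinfun_mult_right.rep_eq)
  have bl\<Psi>: "bounded_linear \<Psi>"
    unfolding \<Psi>_def
    by (intro bounded_linear_compose[OF bounded_bilinear.bounded_linear_right[OF bounded_bilinear_blinfun_compose]]
        bounded_linear_compose[OF bounded_bilinear.bounded_linear_left[OF bounded_bilinear_blinfun_compose]] bounded_linear_blinfun_mult_right)
  have affine: "((\<lambda>x. c + L x) has_derivative blinfun_apply L) (at x)" for x
    by (auto intro!: derivative_eq_intros)
  have h1: "(h has_derivative (\<lambda>v. deriv h w * v)) (at w)" if "w \<in> S" for w
    using holomorphic_derivI[OF h S that] by (simp add: has_field_derivative_def)
  have h2: "(deriv h has_derivative (\<lambda>v. deriv (deriv h) w * v)) (at w)" if "w \<in> S" for w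
    using holomorphic_derivI[OF holomorphic_deriv[OF h S] S that] by (simp add: has_field_derivative_def)
  have "((\<lambda>x. complex_of_real (Re (h (c + L x)))) has_derivative blinfun_apply (\<Phi> (deriv h (c + L x)))) (at x)"
    if "c + L x \<in> S" for x
  proof -
    have "((\<lambda>x. h (c + L x)) has_derivative (\<lambda>v. deriv h (c + L x) * L v)) (at x)"
      by (rule has_derivative_compose[OF affine h1[OF that]])
    from bounded_linear.has_derivative[OF bounded_linear_of_real bounded_linear.has_derivative[OF bounded_linear_Re this]]
    show ?thesis by (simp add: \<Phi>)
  qed
  moreover have "((\<lambda>x. \<Phi> (deriv h (c + L x))) has_derivative blinfun_apply (\<Psi> (deriv (deriv h) (c + L x)))) (at x)"
    if "c + L x \<in> S" for x
  proof -
    have "((\<lambda>x. deriv h (c + L x)) has_derivative (\<lambda>v. deriv (deriv h) (c + L x) * L v)) (at x)"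
      by (rule has_derivative_compose[OF affine h2[OF that]])
    from bounded_linear.has_derivative[OF bl\<Phi> this] show ?thesis by (simp add: \<Psi>)
  qed
  moreover have "continuous_on {x. c + L x \<in> S} (\<lambda>x. \<Psi> (deriv (deriv h) (c + L x)))"
  proof (rule bounded_linear.continuous_on[OF bl\<Psi>])
    have "deriv (deriv h) holomorphic_on S" by (intro holomorphic_deriv h S)
    then show "continuous_on {x. c + L x \<in> S} (\<lambda>x. deriv (deriv h) (c + L x))"
      by (rule continuous_on_compose2[OF holomorphic_on_imp_continuous_on, where f = "\<lambda>x. c + L x"])
         (auto intro!: continuous_intros)
  qed
  ultimately show ?thesis
    unfolding C2_on_def
    by (intro exI[of _ "\<lambda>x. \<Phi> (deriv h (c + L x))"] exI[of _ "\<lambda>x. \<Psi> (deriv (deriv h) (c + L x))"]) auto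
qed

text \<open>The second derivatives in the directions \<open>1\<close> and \<open>\<i>\<close> are \<open>Re (h'' b\<^sup>2)\<close> and \<open>Re (h'' (\<i> b)\<^sup>2)\<close>, which cancel.\<close>

lemma laplacian_Re_holomorphic_affine:
  assumes h: "h holomorphic_on S" and S: "open S" and \<zeta>: "c + b * \<zeta> \<in> S"
  shows "laplacian (\<lambda>\<zeta>. complex_of_real (Re (h (c + b * \<zeta>)))) \<zeta> = 0"
proof -
  let ?g = "\<lambda>\<zeta>. complex_of_real (Re (h (c + b * \<zeta>)))"
  let ?U = "{\<zeta>. c + b * \<zeta> \<in> S}"
  have U: "open ?U" using S by (auto intro!: open_vimage[unfolded vimage_def] continuous_intros)
  have der: "((\<lambda>\<zeta>. complex_of_real (Re (k (c + b * \<zeta>) * w))) has_derivative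
       (\<lambda>v. complex_of_real (Re (deriv k (c + b * \<zeta>) * (b * v) * w)))) (at \<zeta>)"
    if "k holomorphic_on S" "c + b * \<zeta> \<in> S" for k w \<zeta>
  proof -
    have 1: "(k has_derivative (\<lambda>v. deriv k (c + b * \<zeta>) * v)) (at (c + b * \<zeta>))"
      using holomorphic_derivI[OF that(1) S that(2)] by (simp add: has_field_derivative_def)
    have "((\<lambda>\<zeta>. k (c + b * \<zeta>)) has_derivative (\<lambda>v. deriv k (c + b * \<zeta>) * (b * v))) (at \<zeta>)"
      by (rule has_derivative_compose[where f = "\<lambda>\<zeta>. c + b * \<zeta>", OF _ 1]) (auto intro!: derivative_eq_intros)
    then show ?thesis
      by (intro bounded_linear.has_derivative[OF bounded_linear_of_real]
          bounded_linear.has_derivative[OF bounded_linear_Re] has_derivative_mult_left)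
  qed
  have g: "(?g has_derivative (\<lambda>v. complex_of_real (Re (deriv h (c + b * \<zeta>) * (b * v))))) (at \<zeta>)"
    if "\<zeta> \<in> ?U" for \<zeta>
    using der[OF h, of \<zeta> 1] that by simp
  have "dir_deriv (dir_deriv ?g v) v \<zeta> = complex_of_real (Re (deriv (deriv h) (c + b * \<zeta>) * (b * v) * (b * v)))" for v
    by (rule dir_deriv_dir_deriv_eq[OF U _ g der]) (use \<zeta> holomorphic_deriv[OF h S] in auto)
  note this[of 1] this[of \<i>]
  then show ?thesis
    unfolding laplacian_def by (simp add: complex_eq_iff algebra_simps)
qed

lemma C2_on_subset:
  assumes "C2_on g A" "B \<subseteq> A"
  shows "C2_on g B"
proof -
  from assms(1) obtain g' g'' where
    "\<And>x. x \<in> A \<Longrightarrow> (g has_derivative blinfun_apply (g' x)) (at x)"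
    "\<And>x. x \<in> A \<Longrightarrow> (g' has_derivative blinfun_apply (g'' x)) (at x)"
    "continuous_on A g''"
    unfolding C2_on_def by blast
  then show ?thesis
    unfolding C2_on_def using assms(2)
    by (intro exI[of _ g'] exI[of _ g'']) (auto intro: continuous_on_subset)
qed

text \<open>Along a complex line, a complex-linear functional is an affine function of the parameter, so
  both requirements reduce to the two lemmas on affine substitutions.\<close>

lemma pluriharmonic_on_Re_holomorphic_linear:
  fixes L :: "(complex ^ 'n) \<Rightarrow>\<^sub>L complex"
  assumes h: "h holomorphic_on S" and S: "open S"
    and L: "\<And>c x. L (c *s x) = c * L x"
    and \<Omega>: "\<And>x. x \<in> \<Omega> \<Longrightarrow> L x \<in> S"
  shows "pluriharmonic_on (\<lambda>x. complex_of_real (Re (h (L x)))) \<Omega>"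
proof -
  have "C2_on (\<lambda>x. complex_of_real (Re (h (L x)))) \<Omega>"
    by (rule C2_on_subset[OF C2_on_Re_holomorphic_affine[OF h S, of 0 L, simplified]]) (use \<Omega> in auto)
  moreover have "harmonic_on (\<lambda>\<zeta>. complex_of_real (Re (h (L (z + \<zeta> *s \<theta>))))) {\<zeta>. ereal (cmod \<zeta>) < boundary_dist \<Omega> z}"
    if z: "z \<in> \<Omega>" and \<theta>: "norm \<theta> = 1" for z \<theta>
  proof -
    let ?D = "{\<zeta>. ereal (cmod \<zeta>) < boundary_dist \<Omega> z}"
    have L_slice: "L (z + \<zeta> *s \<theta>) = L z + L \<theta> * \<zeta>" for \<zeta>
      by (simp add: blinfun.bilinear_simps L mult.commute)
    have norm_smult: "norm (\<zeta> *s \<theta>) = cmod \<zeta>" for \<zeta>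
      using \<theta> by (simp add: norm_vec_def norm_mult flip: L2_set_right_distrib)
    have D: "L z + L \<theta> * \<zeta> \<in> S" if "\<zeta> \<in> ?D" for \<zeta>
    proof -
      have "z + \<zeta> *s \<theta> \<in> \<Omega>"
      proof (rule ccontr)
        assume "z + \<zeta> *s \<theta> \<notin> \<Omega>"
        from boundary_dist_le[OF z this] that show False by (simp add: dist_norm norm_smult)
      qed
      from \<Omega>[OF this] show ?thesis by (simp only: L_slice)
    qed
    have "C2_on (\<lambda>\<zeta>. complex_of_real (Re (h (L z + L \<theta> * \<zeta>)))) ?D"
      by (rule C2_on_subset[OF C2_on_Re_holomorphic_affine[OF h S, of "L z" "blinfun_mult_right (L \<theta>)",
          unfolded blinfun_mult_right.rep_eq]]) (use D in auto)
    then show ?thesis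
      unfolding harmonic_on_def L_slice
      using laplacian_Re_holomorphic_affine[OF h S D] by blast
  qed
  ultimately show ?thesis by (simp add: pluriharmonic_on_def)
qed

lemma abs_Re_Arctan_less:
  assumes "cmod z < 1"
  shows "\<bar>Re (Arctan z)\<bar> < pi / 4"
proof -
  have "0 < Re ((1 - \<i> * z) / (1 + \<i> * z))" using assms by (simp add: Re_complex_div_lemma)
  then have "\<bar>Im (Ln ((1 - \<i> * z) / (1 + \<i> * z)))\<bar> < pi / 2"
    by (rule Re_Ln_pos_lt_imp)
  then show ?thesis by (simp add: Arctan_def)
qed

section \<open>Sharpness\<close>

lemma lp_norm_axis:
  assumes "p \<noteq> 0"
  shows "lp_norm p (axis i c) = cmod c"
proof -
  have "(\<Sum>j\<in>UNIV. cmod (axis i c $ j) powr p) = (\<Sum>j\<in>UNIV. if j = i then cmod c powr p else 0)"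
    by (intro sum.cong) (auto simp: axis_def)
  then show ?thesis using assms by (simp add: lp_norm_def powr_powr)
qed

lemma le_Limsup_along:
  fixes C :: real
  assumes lim: "((\<lambda>t. g (\<phi> t)) \<longlongrightarrow> C) G" and \<phi>: "filterlim \<phi> F G" and G: "G \<noteq> bot"
  shows "ereal C \<le> Limsup F (\<lambda>x. ereal (g x))"
proof (rule ccontr)
  assume "\<not> ereal C \<le> Limsup F (\<lambda>x. ereal (g x))"
  then obtain y where y: "Limsup F (\<lambda>x. ereal (g x)) < y" "y < ereal C"
    using dense unfolding not_le by blast
  have "eventually (\<lambda>t. ereal (g (\<phi> t)) < y) G"
    using Limsup_lessD[OF y(1)] \<phi> by (rule eventually_compose_filterlim)
  then have "eventually (\<lambda>t. ereal (g (\<phi> t)) \<le> y) G"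
    by (rule eventually_mono) auto
  with lim have "ereal C \<le> y"
    by (intro tendsto_upperbound[OF _ _ G, of "\<lambda>t. ereal (g (\<phi> t))"]) auto
  with y(2) show False by simp
qed

text \<open>The extremal map has the single nonzero coordinate \<open>u = (4 / pi) Re (Arctan (M (L x)))\<close>, where \<open>L\<close> is the
  coordinate along \<open>e = z / \<parallel>z\<parallel>\<close> and \<open>M\<close> is the automorphism of the disc that sends \<open>r = \<parallel>z\<parallel>\<close> to \<open>0\<close>. Here
  \<open>(4 / pi) Arctan\<close> is the conformal map of the disc onto the strip \<open>\<bar>Re\<bar> < 1\<close>, for which the Schwarz-Pick
  inequality is an equality; the factor \<open>1 / (1 - r\<^sup>2)\<close> is \<open>M' r\<close>.\<close>

lemma sharp_pluriharmonic_map: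
  fixes z :: "complex ^ 'n"
  assumes p: "1 < p" and z: "z \<in> ball 0 1"
  shows "\<exists>f :: complex ^ 'n \<Rightarrow> complex ^ 'm.
            pluriharmonic_map_on f (ball 0 1) \<and> f ` ball 0 1 \<subseteq> lp_ball p \<and>
            grad_lp_norm p f z = ereal (4 / pi * (1 / (1 - (norm z)\<^sup>2)))"
proof -
  define r where "r = norm z"
  have r: "0 \<le> r" "r < 1" using z by (auto simp: r_def)
  obtain e :: "complex ^ 'n" where e: "norm e = 1" and ze: "z = r *\<^sub>R e"
  proof (cases "z = 0")
    case True
    \<comment> \<open>At the origin all directions are equivalent; the index \<open>undefined\<close> is an arbitrary choice.\<close>
    with that[of "axis undefined 1"] show ?thesis by (simp add: r_def)
  next
    case False
    with that[of "sgn z"] show ?thesis by (simp add: r_def norm_sgn sgn_div_norm)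
  qed
  define L :: "(complex ^ 'n) \<Rightarrow>\<^sub>L complex" where "L = Blinfun (\<lambda>x. hermitian x e)"
  have "linear (\<lambda>x. hermitian x e)"
    by (rule linearI) (simp_all add: hermitian_def algebra_simps sum.distrib scaleR_sum_right)
  then have L: "L x = hermitian x e" for x
    unfolding L_def by (simp add: bounded_linear_Blinfun_apply linear_conv_bounded_linear)
  have L_ball: "L x \<in> ball 0 1" if "x \<in> ball 0 1" for x
    using norm_hermitian_le[OF e, of x] that by (simp add: L)
  have Lz: "L (z + t *\<^sub>R e) = of_real (r + t)" for t
    by (simp add: ze blinfun.bilinear_simps) (simp add: L hermitian_self e scaleR_conv_of_real)
  define M where "M = Moebius_function 0 (of_real r)"
  have r': "cmod (of_real r) < 1" using r by simp
  have M_less: "cmod (M \<zeta>) < 1" if "cmod \<zeta> < 1" for \<zeta>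
    unfolding M_def by (rule Moebius_function_norm_lt_1[OF r' that])
  define h where "h \<zeta> = of_real (4 / pi) * Arctan (M \<zeta>)" for \<zeta>
  have "(\<lambda>\<zeta>. Arctan (M \<zeta>)) holomorphic_on ball 0 1"
  proof (rule holomorphic_on_compose_gen[where g = Arctan and f = M and t = "ball 0 1", unfolded o_def])
    show "M holomorphic_on ball 0 1" unfolding M_def by (rule Moebius_function_holomorphic[OF r'])
    show "Arctan holomorphic_on ball 0 1"
      by (rule holomorphic_on_Arctan) (auto intro: le_less_trans[OF abs_Im_le_cmod])
  qed (use M_less in auto)
  then have h_hol: "h holomorphic_on ball 0 1" unfolding h_def by (intro holomorphic_intros)
  have h_less: "\<bar>Re (h \<zeta>)\<bar> < 1" if "\<zeta> \<in> ball 0 1" for \<zeta>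
  proof -
    have "\<bar>Re (Arctan (M \<zeta>))\<bar> < pi / 4" using that by (intro abs_Re_Arctan_less M_less) simp
    then show ?thesis by (simp add: h_def abs_mult field_simps)
  qed
  define c where "c = 4 / pi * (1 / (1 - r\<^sup>2))"
  have r2: "r\<^sup>2 < 1" using r by (simp add: abs_square_less_1)
  have M0: "M (of_real r) = 0" by (simp add: M_def Moebius_function_eq_zero)
  have M': "(M has_field_derivative of_real (1 / (1 - r\<^sup>2))) (at (of_real r))"
  proof -
    have "of_real (1 - (cmod (of_real r))\<^sup>2) / (1 - cnj (of_real r) * of_real r)\<^sup>2
        = complex_of_real ((1 - r\<^sup>2) / (1 - r\<^sup>2)\<^sup>2)"
    proof -
      have eq: "1 - cnj (of_real r) * of_real r = complex_of_real (1 - r\<^sup>2)"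
        by (simp add: power2_eq_square)
      show ?thesis unfolding eq of_real_divide of_real_power by simp
    qed
    also have "(1 - r\<^sup>2) / (1 - r\<^sup>2)\<^sup>2 = 1 / (1 - r\<^sup>2)" by (simp add: power2_eq_square)
    finally show ?thesis
      using Moebius_function_has_field_derivative[OF r' r'] by (simp only: M_def)
  qed
  have "(Arctan has_field_derivative 1) (at (M (of_real r)))"
    unfolding M0 using has_field_derivative_Arctan[of 0] by simp
  from DERIV_cmult[OF DERIV_chain2[OF this M'], of "of_real (4 / pi)"]
  have h': "(h has_field_derivative of_real c) (at (of_real r))"
    by (simp add: h_def[abs_def] c_def)
  have h0: "h (of_real r) = 0" by (simp add: h_def M0)

  define u where "u x = Re (h (L x))" for x
  define f :: "complex ^ 'n \<Rightarrow> complex ^ 'm" where "f x = axis undefined (of_real (u x))" for x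
  have lp_f: "lp_norm p (f x) = \<bar>u x\<bar>" for x
    unfolding f_def using p by (subst lp_norm_axis) auto
  have ph: "pluriharmonic_map_on f (ball 0 1)"
    unfolding pluriharmonic_map_on_def
  proof
    fix j :: 'm
    have smult: "L (a *s x) = a * L x" for a x by (simp add: L hermitian_smult_left)
    show "pluriharmonic_on (\<lambda>x. f x $ j) (ball 0 1)"
    proof (cases "j = undefined")
      case True
      then have eq: "(\<lambda>x. f x $ j) = (\<lambda>x. of_real (Re (h (L x))))"
        by (simp add: f_def u_def axis_def)
      show ?thesis
        unfolding eq by (rule pluriharmonic_on_Re_holomorphic_linear[OF h_hol open_ball smult L_ball])
    next
      case False
      then have eq: "(\<lambda>x. f x $ j) = (\<lambda>x. of_real (Re 0))"
        by (simp add: f_def axis_def)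
      show ?thesis
        unfolding eq
        by (rule pluriharmonic_on_Re_holomorphic_linear[OF holomorphic_on_const[of 0] open_ball smult L_ball])
    qed
  qed
  have im: "f ` ball 0 1 \<subseteq> lp_ball p"
    using h_less[OF L_ball] by (auto simp: lp_ball_def lp_f u_def)
  \<comment> \<open>Along the real line \<open>z + t e\<close> the quotient is \<open>\<bar>Re (h (r + t))\<bar> / \<bar>t\<bar>\<close> because \<open>u z = 0\<close>.\<close>
  have "ereal c \<le> grad_lp_norm p f z"
    unfolding grad_lp_norm_def
  proof (rule le_Limsup_along[where \<phi> = "\<lambda>t. z + t *\<^sub>R e" and G = "at 0"])
    have "((\<lambda>w. (h (of_real r + w) - h (of_real r)) / w) \<longlongrightarrow> of_real c) (at 0)"
      using h' by (simp add: DERIV_def)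
    moreover have "filterlim complex_of_real (at 0) (at 0)"
      by (auto simp: filterlim_at eventually_at_filter intro!: tendsto_eq_intros)
    ultimately have "((\<lambda>t. (h (of_real r + of_real t) - h (of_real r)) / of_real t) \<longlongrightarrow> of_real c) (at (0::real))"
      by (rule filterlim_compose)
    from tendsto_rabs[OF tendsto_Re[OF this]]
    have "((\<lambda>t. \<bar>Re (h (of_real (r + t)) / of_real t)\<bar>) \<longlongrightarrow> c) (at (0::real))"
      using r2 by (simp add: h0 c_def)
    then show "((\<lambda>t. \<bar>lp_norm p (f z) - lp_norm p (f (z + t *\<^sub>R e))\<bar> / norm (z - (z + t *\<^sub>R e))) \<longlongrightarrow> c) (at 0)"
      using Lz[of 0] by (simp add: lp_f u_def Lz h0 e Re_divide_of_real abs_divide)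
    show "filterlim (\<lambda>t. z + t *\<^sub>R e) (at z) (at 0)"
      using e by (auto simp: filterlim_at eventually_at_filter intro!: tendsto_eq_intros)
  qed simp
  moreover have "grad_lp_norm p f z \<le> ereal c"
    unfolding c_def r_def by (rule grad_lp_norm_le[OF p ph im z])
  ultimately have "grad_lp_norm p f z = ereal (4 / pi * (1 / (1 - (norm z)\<^sup>2)))"
    by (simp add: c_def r_def)
  with ph im show ?thesis by blast
qed

section \<open>The sharp Schwarz-Pick inequality\<close>

theorem theorem2p2:
  fixes p :: real
  assumes "1 < p"
  shows "(\<forall>f :: complex ^ 'n \<Rightarrow> complex ^ 'm.
            pluriharmonic_map_on f (ball 0 1) \<and> f ` ball 0 1 \<subseteq> lp_ball p \<longrightarrow>
            (\<forall>z\<in>ball 0 1.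
               grad_lp_norm p f z \<le> ereal (4 / pi * (1 / (1 - (norm z)\<^sup>2))))) \<and>
         (\<forall>z\<in>ball 0 1. \<exists>f :: complex ^ 'n \<Rightarrow> complex ^ 'm.
            pluriharmonic_map_on f (ball 0 1) \<and> f ` ball 0 1 \<subseteq> lp_ball p \<and>
            grad_lp_norm p f z = ereal (4 / pi * (1 / (1 - (norm z)\<^sup>2))))"
  using grad_lp_norm_le[OF assms] sharp_pluriharmonic_map[OF assms] by blast

end
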